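(* Let $G$ be a non-cyclic finite group of even order. Then $\mathrm{DNG}(G)=*3$ if and only if the set of maximal subgroups of $G$ of even order does not cover $G$.
   Context: For a nontrivial finite group $G$, the avoidance game $\mathrm{DNG}(G)$ is the impartial game whose positions are the subsets $P\subseteq G$ with $\langle P\rangle\ne G$; the starting position is $\emptyset$; the options of $P$ are the positions of the form $P\cup\{g\}$ with $g\in G\setminus P$ (and $\langle P\cup\{g\}\rangle\neq G$). Two players alternate moves, and a player who cannot move loses (normal play). The nim-number of a position $P$ is defined recursively by $\mathrm{nim}(P)=\mathrm{mex}\{\mathrm{nim}(Q)\mid Q \text{ an option of } P\}$, where $\mathrm{mex}(A)$ is the least non-negative integer not in $A$. The notation $\mathrm{DNG}(G)=*n$ means that the starting position $\emptyset$ has nim-number $n$. A set of subgroups covers $G$ if its union is $G$. *)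

theory Defs
  imports "HOL-Algebra.Elementary_Groups"
begin

definition mex :: "nat set \<Rightarrow> nat" where
  "mex A = (LEAST n. n \<notin> A)"

definition dng_positions :: "('a, 'b) monoid_scheme \<Rightarrow> 'a set set" where
  "dng_positions G = {P. P \<subseteq> carrier G \<and> generate G P \<noteq> carrier G}"

definition dng_opts :: "('a, 'b) monoid_scheme \<Rightarrow> 'a set \<Rightarrow> 'a set set" where
  "dng_opts G P = {insert g P | g. g \<in> carrier G - P \<and> insert g P \<in> dng_positions G}"

(* The finiteness guard only serves to make the recursion terminate; the value for an
   infinite carrier is a dummy. *)
function dng_nim :: "('a, 'b) monoid_scheme \<Rightarrow> 'a set \<Rightarrow> nat" where
  "dng_nim G P = (if finite (carrier G) then mex (dng_nim G ` dng_opts G P) else 0)"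
  by pat_completeness auto
termination
proof (relation "measure (\<lambda>(G, P). card (carrier G - P))", rule wf_measure)
  fix G :: "('a, 'b) monoid_scheme" and P Q
  assume fin: "finite (carrier G)" and "Q \<in> dng_opts G P"
  then obtain g where g: "g \<in> carrier G - P" "Q = insert g P"
    by (auto simp: dng_opts_def)
  then have "carrier G - Q \<subset> carrier G - P" by auto
  then have "card (carrier G - Q) < card (carrier G - P)"
    using fin by (intro psubset_card_mono) auto
  then show "((G, Q), (G, P)) \<in> measure (\<lambda>(G, P). card (carrier G - P))" by simp
qed

declare dng_nim.simps [simp del]

lemma dng_nim_eq_mex:
  "finite (carrier G) \<Longrightarrow> dng_nim G P = mex {dng_nim G Q | Q. Q \<in> dng_opts G P}"
  by (simp add: dng_nim.simps[of G P] setcompr_eq_image)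

(* DNG_number G = n renders DNG(G) = *n. For trivial G the empty set generates G, so it is
   not a legal position and the value is meaningless. *)
definition DNG_number :: "('a, 'b) monoid_scheme \<Rightarrow> nat" where
  "DNG_number G = dng_nim G {}"

definition maximal_subgroup :: "'a set \<Rightarrow> ('a, 'b) monoid_scheme \<Rightarrow> bool" where
  "maximal_subgroup M G \<longleftrightarrow>
     subgroup M G \<and> M \<noteq> carrier G \<and>
     (\<forall>H. subgroup H G \<and> M \<subseteq> H \<longrightarrow> H = M \<or> H = carrier G)"

definition covers :: "'a set set \<Rightarrow> ('a, 'b) monoid_scheme \<Rightarrow> bool" where
  "covers S G \<longleftrightarrow> \<Union>S = carrier G"

end

theory Submission
  imports Defs "HOL-Algebra.Sylow" "HOL-Algebra.Multiplicative_Group"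
begin

text \<open>
  A set \<open>P\<close> is a position exactly when some maximal subgroup contains it, and play
  stops at a maximal subgroup.  What matters about a position is therefore the parity of its
  cardinality and the parities of the orders of the maximal subgroups above it.

  If all maximal subgroups above \<open>P\<close> have even order, the parity of the number of moves
  left is forced and \<open>P\<close> has value \<open>card P mod 2\<close>; if they all have odd order, it
  is forced too and the value is \<open>1 - card P mod 2\<close>.  If both parities occur above
  \<open>P\<close>, one can always adjoin an element of even order (Cauchy's theorem) and so enter
  the first class.  If the second class can also be entered with one move, the values become
  3 for \<open>card P\<close> even and 2 for \<open>card P\<close> odd; if it cannot, the values remain those
  of the first class.  Induction on the number of unused group elements proves all of this at once
  (\<open>dng_nim_eq_dng_value\<close>).  The even mixed positions of value 3 are the delicate case:
  they need an option of value 2, that is, a move that stays in the same class, and this comes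
  from the fact that the intersection of the maximal subgroups above \<open>P\<close> has odd order, so
  it is not exhausted by \<open>P\<close> (\<open>exists_neutral_move\<close>).

  Apply this to the empty position.  Since the group is not cyclic, every single element lies in
  a maximal subgroup; as the group has even order, some maximal subgroup has even order.  So the
  value is 3 exactly when some element lies in maximal subgroups of odd order only, that is,
  when the maximal subgroups of even order do not cover the group.
\<close>

section \<open>Minimal excludants\<close>

lemma mex_eqI:
  assumes "n \<notin> A" and "\<And>m. m < n \<Longrightarrow> m \<in> A"
  shows "mex A = n"
  unfolding mex_def
proof (rule Least_equality)
  show "n \<notin> A" by (rule assms(1))
  show "n \<le> m" if "m \<notin> A" for m using assms(2) that by (meson not_le)
qed

section \<open>Subgroups of even order\<close>

lemma (in group) card_subgroup_dvd:
  assumes "subgroup H G" "subgroup K G" "H \<subseteq> K"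
  shows "card H dvd card K"
proof -
  interpret K: group "G\<lparr>carrier := K\<rparr>"
    using assms(2) by (rule subgroup_imp_group)
  have "subgroup H (G\<lparr>carrier := K\<rparr>)"
    using assms by (rule subgroup_incl)
  note K.lagrange[OF this]
  also have "order (G\<lparr>carrier := K\<rparr>) = card K" by (simp add: order_def)
  finally show ?thesis by (metis dvd_triv_right)
qed

locale fin_group = group +
  assumes finite_carrier [simp]: "finite (carrier G)"
begin

lemma finite_subgroup: "subgroup H G \<Longrightarrow> finite H"
  using finite_subset[OF subgroup.subset finite_carrier] .

lemma even_card_if_mem_even_ord:
  assumes "subgroup H G" "t \<in> H" "even (ord t)"
  shows "even (card H)"
proof -
  have t: "t \<in> carrier G" using assms(1,2) by (rule subgroup.mem_carrier)
  have "generate G {t} \<subseteq> H"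
    using assms by (intro generate_subgroup_incl) auto
  then have "ord t dvd card H"
    using card_subgroup_dvd[OF generate_is_subgroup assms(1), of "{t}"] t
    by (simp add: generate_pow_card)
  then show ?thesis using assms(3) dvd_trans by blast
qed

text \<open>
  The case \<open>p = 2\<close> of Cauchy's theorem: a subgroup of order 2, which exists by
  Sylow, is generated by its non-identity element.
\<close>
lemma obtain_even_ord:
  assumes "subgroup H G" "even (card H)"
  obtains t where "t \<in> H" "even (ord t)"
proof -
  interpret H: group "G\<lparr>carrier := H\<rparr>"
    using assms(1) by (rule subgroup_imp_group)
  obtain m where "card H = 2 ^ 1 * m" using assms(2) by auto
  then have "order (G\<lparr>carrier := H\<rparr>) = 2 ^ 1 * m" by (simp add: order_def)
  moreover have "finite (carrier (G\<lparr>carrier := H\<rparr>))"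
    using assms(1) by (simp add: finite_subgroup)
  ultimately obtain K where K: "subgroup K (G\<lparr>carrier := H\<rparr>)" "card K = 2 ^ 1"
    using sylow_thm[of 2 "G\<lparr>carrier := H\<rparr>" 1 m] two_is_prime_nat H.is_group by blast
  have KG: "subgroup K G" using K(1) assms(1) by (rule incl_subgroup[rotated])
  have KH: "K \<subseteq> H" using subgroup.subset[OF K(1)] by simp
  have "K \<noteq> {\<one>}" using K(2) by auto
  then obtain t where t: "t \<in> K" "t \<noteq> \<one>"
    using subgroup.one_closed[OF KG] by blast
  have tG: "t \<in> carrier G" using KG t(1) by (rule subgroup.mem_carrier)
  have "generate G {t} \<subseteq> K" using t KG by (intro generate_subgroup_incl) auto
  then have "ord t dvd 2"
    using card_subgroup_dvd[OF generate_is_subgroup KG, of "{t}"] tG K(2)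
    by (simp add: generate_pow_card)
  then have "ord t = 1 \<or> ord t = 2"
    using two_is_prime_nat unfolding prime_nat_iff by blast
  moreover have "ord t \<noteq> 1" using t(2) ord_eq_1[OF tG] by simp
  ultimately have "even (ord t)" by simp
  then show thesis using that t(1) KH by blast
qed

section \<open>Positions and the maximal subgroups above them\<close>

definition maximals_above :: "'a set \<Rightarrow> 'a set set" where
  "maximals_above P = {M. maximal_subgroup M G \<and> P \<subseteq> M}"

lemma maximals_above_subgroup: "M \<in> maximals_above P \<Longrightarrow> subgroup M G"
  by (simp add: maximals_above_def maximal_subgroup_def)

lemma maximals_above_subset: "M \<in> maximals_above P \<Longrightarrow> P \<subseteq> M"
  by (simp add: maximals_above_def)

lemma finite_if_maximals_above: "M \<in> maximals_above P \<Longrightarrow> finite P"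
  by (meson finite_subgroup finite_subset maximals_above_subgroup maximals_above_subset)

lemma maximals_above_insert:
  "M \<in> maximals_above (insert g P) \<longleftrightarrow> g \<in> M \<and> M \<in> maximals_above P"
  by (auto simp: maximals_above_def)

lemma position_iff: "P \<in> dng_positions G \<longleftrightarrow> maximals_above P \<noteq> {}"
proof
  assume "P \<in> dng_positions G"
  then have P: "P \<subseteq> carrier G" "generate G P \<noteq> carrier G"
    by (auto simp: dng_positions_def)
  let ?S = "{H. subgroup H G \<and> H \<noteq> carrier G}"
  have "?S \<subseteq> Pow (carrier G)" by (auto dest: subgroup.subset)
  then have "finite ?S" by (rule finite_subset) simp
  moreover have "generate G P \<in> ?S" using P by (simp add: generate_is_subgroup)
  ultimately obtain M where M: "M \<in> ?S" "generate G P \<subseteq> M" "\<forall>H\<in>?S. M \<subseteq> H \<longrightarrow> M = H"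
    using finite_has_maximal2[of ?S "generate G P"] by blast
  then have "maximal_subgroup M G" by (auto simp: maximal_subgroup_def)
  moreover have "P \<subseteq> M" using M(2) by (auto intro: generate.incl)
  ultimately show "maximals_above P \<noteq> {}" by (auto simp: maximals_above_def)
next
  assume "maximals_above P \<noteq> {}"
  then obtain M where M: "subgroup M G" "M \<noteq> carrier G" "P \<subseteq> M"
    by (auto simp: maximals_above_def maximal_subgroup_def)
  have "generate G P \<subseteq> M" using M(3,1) by (rule generate_subgroup_incl)
  moreover have "M \<subseteq> carrier G" using M(1) by (rule subgroup.subset)
  ultimately show "P \<in> dng_positions G" using M by (auto simp: dng_positions_def)
qed

lemma opts_iff:
  "Q \<in> dng_opts G P \<longleftrightarrow> (\<exists>g. Q = insert g P \<and> g \<notin> P \<and> maximals_above Q \<noteq> {})"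
proof -
  have "g \<in> carrier G" if "M \<in> maximals_above (insert g P)" for g M
    using that by (meson maximals_above_insert maximals_above_subgroup subgroup.mem_carrier)
  then show ?thesis unfolding dng_opts_def position_iff by blast
qed

lemma insert_mem_opts:
  "\<lbrakk>M \<in> maximals_above P; g \<in> M; g \<notin> P\<rbrakk> \<Longrightarrow> insert g P \<in> dng_opts G P"
  unfolding opts_iff by (metis empty_iff maximals_above_insert)

lemma opts_position: "Q \<in> dng_opts G P \<Longrightarrow> maximals_above Q \<noteq> {}"
  by (auto simp: opts_iff)

lemma opts_maximals_above: "Q \<in> dng_opts G P \<Longrightarrow> maximals_above Q \<subseteq> maximals_above P"
  by (auto simp: opts_iff maximals_above_insert)

lemma opts_parity:
  assumes "Q \<in> dng_opts G P"
  shows "even (card Q) \<longleftrightarrow> odd (card P)"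
proof -
  obtain g where g: "Q = insert g P" "g \<notin> P" and "maximals_above Q \<noteq> {}"
    using assms by (auto simp: opts_iff)
  then have "finite P" using finite_if_maximals_above by (metis equals0I finite_insert)
  then show ?thesis using g by simp
qed

definition odd_only :: "'a set \<Rightarrow> bool" where
  "odd_only P \<longleftrightarrow> (\<forall>M\<in>maximals_above P. odd (card M))"

lemma opts_odd_only: "\<lbrakk>Q \<in> dng_opts G P; odd_only P\<rbrakk> \<Longrightarrow> odd_only Q"
  using opts_maximals_above by (auto simp: odd_only_def)

text \<open>
  By Lagrange, every maximal subgroup above such a position has even order.  Later positions keep
  the element \<open>t\<close>, so from here on the parity of the length of the game is settled.
\<close>
lemma not_odd_only_if_even_ord:
  assumes "maximals_above P \<noteq> {}" "t \<in> P" "even (ord t)"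
  shows "\<not> odd_only P"
  using assms even_card_if_mem_even_ord maximals_above_subgroup maximals_above_subset
  unfolding odd_only_def by blast

lemma odd_only_exists_opt:
  assumes "maximals_above P \<noteq> {}" "odd_only P" "even (card P)"
  shows "dng_opts G P \<noteq> {}"
proof -
  obtain M where M: "M \<in> maximals_above P" using assms(1) by blast
  then have "P \<noteq> M" using assms(2,3) by (auto simp: odd_only_def)
  then obtain g where "g \<in> M" "g \<notin> P" using maximals_above_subset[OF M] by blast
  then show ?thesis using insert_mem_opts[OF M] by blast
qed

text \<open>
  A maximal subgroup of even order above \<open>P\<close> contains an element of even order, and adjoining
  it is a move unless \<open>P\<close> contains it already.  In that case any move at all will do.  There
  is one, because no option of \<open>P\<close> can then have only odd maximal subgroups above it, so
  \<open>card P\<close> is odd and \<open>P\<close> cannot fill a subgroup of even order.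
\<close>
lemma exists_even_ord_opt:
  assumes "\<not> odd_only P" and "odd (card P) \<or> (\<exists>Q\<in>dng_opts G P. odd_only Q)"
  obtains Q t where "Q \<in> dng_opts G P" "t \<in> Q" "even (ord t)"
proof -
  obtain M where M: "M \<in> maximals_above P" "even (card M)"
    using assms(1) by (auto simp: odd_only_def)
  obtain t where t: "t \<in> M" "even (ord t)"
    using obtain_even_ord[OF maximals_above_subgroup[OF M(1)] M(2)] .
  show thesis
  proof (cases "t \<in> P")
    case False
    then show thesis using insert_mem_opts[OF M(1) t(1)] t(2) that by blast
  next
    case True
    have "\<not> odd_only Q" if "Q \<in> dng_opts G P" for Q
      using not_odd_only_if_even_ord[OF opts_position[OF that] _ t(2)] True that
      by (auto simp: opts_iff)
    then have "P \<noteq> M" using assms(2) M(2) by auto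
    then obtain g where "g \<in> M" "g \<notin> P" using maximals_above_subset[OF M(1)] by blast
    then show thesis using insert_mem_opts[OF M(1)] True t(2) that by blast
  qed
qed

text \<open>
  The intersection of all maximal subgroups above \<open>P\<close> lies in one of odd order, so it has
  odd order itself and is strictly larger than an even set \<open>P\<close>; any further element of it can be
  played without losing a maximal subgroup.
\<close>
lemma exists_neutral_move:
  assumes "M \<in> maximals_above P" "odd (card M)" "even (card P)"
  obtains c where "c \<notin> P" "maximals_above (insert c P) = maximals_above P"
proof -
  let ?C = "\<Inter>(maximals_above P)"
  have C: "subgroup ?C G"
    using assms(1) by (intro subgroups_Inter) (auto intro: maximals_above_subgroup)
  have "card ?C dvd card M"
    using assms(1) by (intro card_subgroup_dvd[OF C maximals_above_subgroup]) auto
  then have "odd (card ?C)" using assms(2) dvd_trans by blast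
  then have "?C \<noteq> P" using assms(3) by auto
  moreover have "P \<subseteq> ?C" using maximals_above_subset by blast
  ultimately obtain c where "c \<in> ?C" "c \<notin> P" by blast
  moreover from this have "maximals_above (insert c P) = maximals_above P"
    by (auto simp: maximals_above_insert)
  ultimately show thesis using that by blast
qed

section \<open>The values of all positions\<close>

definition dng_value :: "'a set \<Rightarrow> nat" where
  "dng_value P =
     (if odd_only P then (if even (card P) then 1 else 0)
      else if \<exists>Q\<in>dng_opts G P. odd_only Q then (if even (card P) then 3 else 2)
      else (if even (card P) then 0 else 1))"

lemma dng_value_even_ord:
  assumes "maximals_above P \<noteq> {}" "t \<in> P" "even (ord t)"
  shows "dng_value P = (if even (card P) then 0 else 1)"
proof -
  have "\<not> odd_only Q" if "Q \<in> dng_opts G P" for Q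
    using not_odd_only_if_even_ord[OF opts_position[OF that] _ assms(3)] assms(2) that
    by (auto simp: opts_iff)
  then show ?thesis using not_odd_only_if_even_ord[OF assms] by (auto simp: dng_value_def)
qed

lemma exists_opt_dng_value:
  assumes "\<not> odd_only P" and "odd (card P) \<or> (\<exists>Q\<in>dng_opts G P. odd_only Q)"
  shows "\<exists>Q\<in>dng_opts G P. dng_value Q = (if even (card P) then 1 else 0)"
proof -
  obtain Q t where Q: "Q \<in> dng_opts G P" "t \<in> Q" "even (ord t)"
    using exists_even_ord_opt[OF assms] .
  then show ?thesis
    using dng_value_even_ord[OF opts_position[OF Q(1)] Q(2,3)] opts_parity[OF Q(1)]
    by (intro bexI[of _ Q]) simp_all
qed

text \<open>
  An option of value 2 for an even mixed position: after a neutral move the position has the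
  same maximal subgroups above it, and the move that made them all odd is still available.
\<close>
lemma exists_opt_dng_value_2:
  assumes "\<not> odd_only P" "R \<in> dng_opts G P" "odd_only R" "even (card P)"
  shows "\<exists>Q\<in>dng_opts G P. dng_value Q = 2"
proof -
  obtain g where g: "R = insert g P" using assms(2) by (auto simp: opts_iff)
  obtain M where "M \<in> maximals_above R" using opts_position[OF assms(2)] by blast
  then have M: "M \<in> maximals_above P" "odd (card M)" "g \<in> M"
    using assms(3) by (auto simp: g maximals_above_insert odd_only_def)
  obtain c where c: "c \<notin> P" "maximals_above (insert c P) = maximals_above P"
    using exists_neutral_move[OF M(1,2) assms(4)] .
  let ?Q = "insert c P"
  have Q: "?Q \<in> dng_opts G P" using c M(1) by (auto simp: opts_iff)
  have mixed: "\<not> odd_only ?Q" using assms(1) c(2) by (simp add: odd_only_def)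
  have eq: "maximals_above (insert g ?Q) = maximals_above R"
    using c(2) g by (auto simp: maximals_above_insert)
  then have odd: "odd_only (insert g ?Q)" using assms(3) by (simp add: odd_only_def)
  with mixed have "g \<notin> ?Q" by (auto simp: insert_absorb)
  moreover have "M \<in> maximals_above ?Q" using c(2) M(1) by simp
  ultimately have "insert g ?Q \<in> dng_opts G ?Q" using M(3) by (intro insert_mem_opts)
  then have "dng_value ?Q = 2"
    using mixed odd opts_parity[OF Q] assms(4) by (auto simp: dng_value_def)
  then show ?thesis using Q by blast
qed

lemma dng_value_eq_mex:
  assumes "maximals_above P \<noteq> {}"
  shows "mex (dng_value ` dng_opts G P) = dng_value P"
proof -
  let ?V = "dng_value ` dng_opts G P"
  consider (odd) "odd_only P"
    | (rich) R where "\<not> odd_only P" "R \<in> dng_opts G P" "odd_only R"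
    | (poor) "\<not> odd_only P" "\<forall>Q\<in>dng_opts G P. \<not> odd_only Q"
    by blast
  then show ?thesis
  proof cases
    case odd
    have val: "dng_value Q = (if even (card P) then 0 else 1)" if "Q \<in> dng_opts G P" for Q
      using opts_parity[OF that] opts_odd_only[OF that odd] by (simp add: dng_value_def)
    show ?thesis
    proof (cases "even (card P)")
      case True
      then have "?V = {0}" using val odd_only_exists_opt[OF assms odd True] by auto
      then show ?thesis using odd True by (intro mex_eqI) (auto simp: dng_value_def)
    next
      case False
      then have "0 \<notin> ?V" using val by auto
      then show ?thesis using odd False by (intro mex_eqI) (auto simp: dng_value_def)
    qed
  next
    case rich
    have entry: "\<exists>Q\<in>dng_opts G P. odd_only Q" using rich by blast
    have R: "dng_value R = (if even (card P) then 0 else 1)"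
      using opts_parity[OF rich(2)] rich(3) by (simp add: dng_value_def)
    obtain S where S: "S \<in> dng_opts G P" "dng_value S = (if even (card P) then 1 else 0)"
      using exists_opt_dng_value rich(1) entry by blast
    have V01: "0 \<in> ?V" "1 \<in> ?V" using R S rich(2) by (force split: if_splits)+
    show ?thesis
    proof (cases "even (card P)")
      case True
      have two: "2 \<in> ?V" using exists_opt_dng_value_2[OF rich True] by force
      have "dng_value Q \<noteq> 3" if "Q \<in> dng_opts G P" for Q
        using opts_parity[OF that] True by (simp add: dng_value_def)
      then have "mex ?V = 3"
      proof (intro mex_eqI)
        show "m \<in> ?V" if "m < 3" for m
        proof -
          have "m = 0 \<or> m = 1 \<or> m = 2" using that by auto
          then show ?thesis using V01 two by blast
        qed
      qed (metis imageE)
      then show ?thesis using rich(1) entry True by (simp add: dng_value_def)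
    next
      case False
      have "dng_value Q \<noteq> 2" if "Q \<in> dng_opts G P" for Q
        using opts_parity[OF that] False by (simp add: dng_value_def)
      then have "mex ?V = 2"
      proof (intro mex_eqI)
        show "m \<in> ?V" if "m < 2" for m
        proof -
          have "m = 0 \<or> m = 1" using that by auto
          then show ?thesis using V01 by blast
        qed
      qed (metis imageE)
      then show ?thesis using rich(1) entry False by (simp add: dng_value_def)
    qed
  next
    case poor
    show ?thesis
    proof (cases "even (card P)")
      case True
      have "dng_value Q \<noteq> 0" if "Q \<in> dng_opts G P" for Q
        using opts_parity[OF that] True poor(2) that by (simp add: dng_value_def)
      then have "0 \<notin> ?V" by (metis imageE)
      then have "mex ?V = 0" by (intro mex_eqI) simp_all
      then show ?thesis using poor True by (auto simp: dng_value_def)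
    next
      case False
      have zero: "0 \<in> ?V" using exists_opt_dng_value[OF poor(1)] False by force
      have "dng_value Q \<noteq> 1" if "Q \<in> dng_opts G P" for Q
        using opts_parity[OF that] False poor(2) that by (simp add: dng_value_def)
      then have "1 \<notin> ?V" by (metis imageE)
      then have "mex ?V = 1" using zero by (intro mex_eqI) simp_all
      then show ?thesis using poor False by (auto simp: dng_value_def)
    qed
  qed
qed

theorem dng_nim_eq_dng_value:
  assumes "maximals_above P \<noteq> {}"
  shows "dng_nim G P = dng_value P"
  using assms
proof (induction "card (carrier G - P)" arbitrary: P rule: less_induct)
  case less
  have "dng_nim G Q = dng_value Q" if Q: "Q \<in> dng_opts G P" for Q
  proof (rule less.hyps)
    have "carrier G - Q \<subset> carrier G - P" using Q by (auto simp: dng_opts_def)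
    then show "card (carrier G - Q) < card (carrier G - P)"
      by (intro psubset_card_mono) auto
    show "maximals_above Q \<noteq> {}" using Q by (rule opts_position)
  qed
  then have "dng_nim G ` dng_opts G P = dng_value ` dng_opts G P" by simp
  then show ?case
    using dng_value_eq_mex[OF less.prems] by (simp add: dng_nim.simps[of G P])
qed

lemma not_cyclic_singleton_position:
  assumes "\<not> cyclic_group G" "g \<in> carrier G"
  shows "maximals_above {g} \<noteq> {}"
proof -
  have "generate G {g} \<noteq> carrier G"
    using assms by (auto simp: cyclic_group_def subgroup_generated_def)
  then show ?thesis using assms(2) by (simp add: position_iff[symmetric] dng_positions_def)
qed

end

theorem proposition6p2:
  fixes G :: "('a, 'b) monoid_scheme"
  assumes "group G"
    and "finite (carrier G)"
    and "\<not> cyclic_group G"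
    and "even (order G)"
  shows "DNG_number G = 3 \<longleftrightarrow> \<not> covers {M. maximal_subgroup M G \<and> even (card M)} G"
proof -
  interpret fin_group G
    using assms by (simp add: fin_group_def fin_group_axioms_def)
  note single = not_cyclic_singleton_position[OF assms(3)]
  obtain t where t: "t \<in> carrier G" "even (ord t)"
    using obtain_even_ord[OF subgroup_self] assms(4) by (auto simp: order_def)
  have mixed: "\<not> odd_only {}"
    using not_odd_only_if_even_ord[OF single[OF t(1)] _ t(2)]
    by (auto simp: odd_only_def maximals_above_insert)
  then have "maximals_above {} \<noteq> {}" by (auto simp: odd_only_def)
  then have "DNG_number G = dng_value {}"
    unfolding DNG_number_def by (rule dng_nim_eq_dng_value)
  then have "DNG_number G = 3 \<longleftrightarrow> (\<exists>Q\<in>dng_opts G {}. odd_only Q)"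
    using mixed by (simp add: dng_value_def)
  also have "dng_opts G {} = (\<lambda>g. {g}) ` carrier G"
    using single by (auto simp: dng_opts_def position_iff)
  also have "(\<exists>Q\<in>(\<lambda>g. {g}) ` carrier G. odd_only Q) \<longleftrightarrow> (\<exists>g\<in>carrier G. odd_only {g})"
    by simp
  also have "\<dots> \<longleftrightarrow> \<not> carrier G \<subseteq> \<Union>{M. maximal_subgroup M G \<and> even (card M)}"
    by (auto simp: odd_only_def maximals_above_def)
  also have "\<dots> \<longleftrightarrow> \<not> covers {M. maximal_subgroup M G \<and> even (card M)} G"
    by (auto simp: covers_def maximal_subgroup_def dest: subgroup.subset)
  finally show ?thesis .
qed

end
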